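(* Let $F:\mathcal{C}\to\mathcal{D}$ be a functor and let $F^\natural:\mathcal{C}^\natural\to\mathcal{D}^\natural$ be its idempotent completion. Then: (1) $F$ is semiseparable if and only if so is $F^\natural$; (2) $F$ is separable if and only if so is $F^\natural$; (3) $F$ is naturally full if and only if so is $F^\natural$.
   Context: For a functor $F:\mathcal{C}\to\mathcal{D}$ let $\mathcal{F}:\mathrm{Hom}_{\mathcal{C}}(-,-)\to\mathrm{Hom}_{\mathcal{D}}(F-,F-)$ be the natural transformation $\mathcal{F}_{C,C'}(f)=F(f)$. $F$ is separable (resp. naturally full, resp. semiseparable) if there is a natural transformation $\mathcal{P}:\mathrm{Hom}_{\mathcal{D}}(F-,F-)\to\mathrm{Hom}_{\mathcal{C}}(-,-)$ with $\mathcal{P}\circ\mathcal{F}=\mathrm{Id}$ (resp. $\mathcal{F}\circ\mathcal{P}=\mathrm{Id}$, resp. $\mathcal{F}\circ\mathcal{P}\circ\mathcal{F}=\mathcal{F}$). The idempotent completion $\mathcal{C}^\natural$ of a category $\mathcal{C}$ has as objects the pairs $(X,e)$ with $X$ an object of $\mathcal{C}$ and $e:X\to X$ idempotent; a morphism $f:(X,e)\to(X',e')$ is a morphism $f:X\to X'$ in $\mathcal{C}$ with $f=e'\circ f\circ e$; composition is that of $\mathcal{C}$ and $\mathrm{Id}_{(X,e)}=e$. A functor $F:\mathcal{C}\to\mathcal{D}$ induces its completion $F^\natural:\mathcal{C}^\natural\to\mathcal{D}^\natural$, $F^\natural(X,e)=(FX,Fe)$, $F^\natural(f)=F(f)$.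 *)

theory Defs
  imports Main
begin

section \<open>Categories and functors\<close>

text \<open>
  A category is given by a family of hom-sets.  The hom-sets are not required to be disjoint
  (in the idempotent completion the same morphism of the base category lies in many of them),
  so composition and the action of a functor on morphisms take the objects as explicit arguments:
  \<open>Comp C X Y Z g f\<close> is the composite of \<open>f : X \<rightarrow> Y\<close> and \<open>g : Y \<rightarrow> Z\<close>, and \<open>FMor F X Y f\<close> is the
  image of \<open>f : X \<rightarrow> Y\<close>.
\<close>

record ('o, 'm) precategory =
  Obj :: "'o set"
  Hom :: "'o \<Rightarrow> 'o \<Rightarrow> 'm set"
  Comp :: "'o \<Rightarrow> 'o \<Rightarrow> 'o \<Rightarrow> 'm \<Rightarrow> 'm \<Rightarrow> 'm"
  Ident :: "'o \<Rightarrow> 'm"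

locale category =
  fixes C :: "('o, 'm) precategory"
  assumes Comp_closed:
      "\<lbrakk>X \<in> Obj C; Y \<in> Obj C; Z \<in> Obj C; f \<in> Hom C X Y; g \<in> Hom C Y Z\<rbrakk>
        \<Longrightarrow> Comp C X Y Z g f \<in> Hom C X Z"
    and Ident_closed: "X \<in> Obj C \<Longrightarrow> Ident C X \<in> Hom C X X"
    and Comp_assoc:
      "\<lbrakk>W \<in> Obj C; X \<in> Obj C; Y \<in> Obj C; Z \<in> Obj C;
        f \<in> Hom C W X; g \<in> Hom C X Y; h \<in> Hom C Y Z\<rbrakk>
        \<Longrightarrow> Comp C W Y Z h (Comp C W X Y g f) = Comp C W X Z (Comp C X Y Z h g) f"
    and Ident_right:
      "\<lbrakk>X \<in> Obj C; Y \<in> Obj C; f \<in> Hom C X Y\<rbrakk> \<Longrightarrow> Comp C X X Y f (Ident C X) = f"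
    and Ident_left:
      "\<lbrakk>X \<in> Obj C; Y \<in> Obj C; f \<in> Hom C X Y\<rbrakk> \<Longrightarrow> Comp C X Y Y (Ident C Y) f = f"

record ('o, 'm, 'p, 'n) prefunctor =
  FObj :: "'o \<Rightarrow> 'p"
  FMor :: "'o \<Rightarrow> 'o \<Rightarrow> 'm \<Rightarrow> 'n"

locale cat_functor = dom: category C + cod: category D
  for C :: "('o, 'm) precategory" and D :: "('p, 'n) precategory" +
  fixes F :: "('o, 'm, 'p, 'n) prefunctor"
  assumes FObj_closed: "X \<in> Obj C \<Longrightarrow> FObj F X \<in> Obj D"
    and FMor_closed:
      "\<lbrakk>X \<in> Obj C; Y \<in> Obj C; f \<in> Hom C X Y\<rbrakk> \<Longrightarrow> FMor F X Y f \<in> Hom D (FObj F X) (FObj F Y)"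
    and FMor_Comp:
      "\<lbrakk>X \<in> Obj C; Y \<in> Obj C; Z \<in> Obj C; f \<in> Hom C X Y; g \<in> Hom C Y Z\<rbrakk>
        \<Longrightarrow> FMor F X Z (Comp C X Y Z g f)
            = Comp D (FObj F X) (FObj F Y) (FObj F Z) (FMor F Y Z g) (FMor F X Y f)"
    and FMor_Ident: "X \<in> Obj C \<Longrightarrow> FMor F X X (Ident C X) = Ident D (FObj F X)"


section \<open>Set-valued bifunctors and natural transformations\<close>

text \<open>
  Data of a functor \<open>S : C\<^sup>o\<^sup>p \<times> C \<rightarrow> Set\<close>.  For \<open>a : X' \<rightarrow> X\<close> and \<open>b : Y \<rightarrow> Y'\<close>,
  \<open>BMor S X X' Y Y' a b\<close> is the induced map \<open>S(X, Y) \<rightarrow> S(X', Y')\<close>.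
\<close>

record ('o, 'm, 's) bifunctor =
  BSet :: "'o \<Rightarrow> 'o \<Rightarrow> 's set"
  BMor :: "'o \<Rightarrow> 'o \<Rightarrow> 'o \<Rightarrow> 'o \<Rightarrow> 'm \<Rightarrow> 'm \<Rightarrow> 's \<Rightarrow> 's"

text \<open>The bifunctor \<open>Hom\<^sub>C(-,-)\<close>: \<open>h \<mapsto> b \<circ> h \<circ> a\<close>.\<close>

definition hom_bif :: "('o, 'm) precategory \<Rightarrow> ('o, 'm, 'm) bifunctor" where
  "hom_bif C =
    \<lparr>BSet = Hom C,
     BMor = (\<lambda>X X' Y Y' a b h. Comp C X' Y Y' b (Comp C X' X Y h a))\<rparr>"

text \<open>The bifunctor \<open>S(F-,F-)\<close> on the domain of \<open>F\<close>.\<close>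

definition pull_bif ::
  "('o, 'm, 'p, 'n) prefunctor \<Rightarrow> ('p, 'n, 's) bifunctor \<Rightarrow> ('o, 'm, 's) bifunctor" where
  "pull_bif F S =
    \<lparr>BSet = (\<lambda>X Y. BSet S (FObj F X) (FObj F Y)),
     BMor = (\<lambda>X X' Y Y' a b. BMor S (FObj F X) (FObj F X') (FObj F Y) (FObj F Y')
               (FMor F X' X a) (FMor F Y Y' b))\<rparr>"

definition natural_transformation ::
  "('o, 'm) precategory \<Rightarrow> ('o, 'm, 's) bifunctor \<Rightarrow> ('o, 'm, 't) bifunctor
    \<Rightarrow> ('o \<Rightarrow> 'o \<Rightarrow> 's \<Rightarrow> 't) \<Rightarrow> bool" where
  "natural_transformation C S T \<eta> \<longleftrightarrow>
    (\<forall>X\<in>Obj C. \<forall>Y\<in>Obj C. \<forall>s\<in>BSet S X Y. \<eta> X Y s \<in> BSet T X Y) \<and>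
    (\<forall>X\<in>Obj C. \<forall>X'\<in>Obj C. \<forall>Y\<in>Obj C. \<forall>Y'\<in>Obj C.
      \<forall>a\<in>Hom C X' X. \<forall>b\<in>Hom C Y Y'. \<forall>s\<in>BSet S X Y.
        \<eta> X' Y' (BMor S X X' Y Y' a b s) = BMor T X X' Y Y' a b (\<eta> X Y s))"

text \<open>Equality of natural transformations with source \<open>S\<close>: values outside \<open>S\<close> are junk.\<close>

definition nt_eq ::
  "('o, 'm) precategory \<Rightarrow> ('o, 'm, 's) bifunctor
    \<Rightarrow> ('o \<Rightarrow> 'o \<Rightarrow> 's \<Rightarrow> 't) \<Rightarrow> ('o \<Rightarrow> 'o \<Rightarrow> 's \<Rightarrow> 't) \<Rightarrow> bool" where
  "nt_eq C S \<eta> \<theta> \<longleftrightarrow> (\<forall>X\<in>Obj C. \<forall>Y\<in>Obj C. \<forall>s\<in>BSet S X Y. \<eta> X Y s = \<theta> X Y s)"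

definition nt_comp ::
  "('o \<Rightarrow> 'o \<Rightarrow> 't \<Rightarrow> 'u) \<Rightarrow> ('o \<Rightarrow> 'o \<Rightarrow> 's \<Rightarrow> 't) \<Rightarrow> 'o \<Rightarrow> 'o \<Rightarrow> 's \<Rightarrow> 'u" where
  "nt_comp \<eta> \<theta> X Y = \<eta> X Y \<circ> \<theta> X Y"

definition nt_id :: "'o \<Rightarrow> 'o \<Rightarrow> 's \<Rightarrow> 's" where
  "nt_id X Y = id"


section \<open>Separable, naturally full and semiseparable functors\<close>

text \<open>
  The canonical transformation \<open>Hom\<^sub>C(-,-) \<rightarrow> Hom\<^sub>D(F-,F-)\<close>, \<open>f \<mapsto> F(f)\<close>, is \<open>FMor F\<close> itself.
\<close>

definition separable ::
  "('o, 'm) precategory \<Rightarrow> ('p, 'n) precategory \<Rightarrow> ('o, 'm, 'p, 'n) prefunctor \<Rightarrow> bool" where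
  "separable C D F \<longleftrightarrow>
    (\<exists>P. natural_transformation C (pull_bif F (hom_bif D)) (hom_bif C) P \<and>
         nt_eq C (hom_bif C) (nt_comp P (FMor F)) nt_id)"

definition naturally_full ::
  "('o, 'm) precategory \<Rightarrow> ('p, 'n) precategory \<Rightarrow> ('o, 'm, 'p, 'n) prefunctor \<Rightarrow> bool" where
  "naturally_full C D F \<longleftrightarrow>
    (\<exists>P. natural_transformation C (pull_bif F (hom_bif D)) (hom_bif C) P \<and>
         nt_eq C (pull_bif F (hom_bif D)) (nt_comp (FMor F) P) nt_id)"

definition semiseparable ::
  "('o, 'm) precategory \<Rightarrow> ('p, 'n) precategory \<Rightarrow> ('o, 'm, 'p, 'n) prefunctor \<Rightarrow> bool" where
  "semiseparable C D F \<longleftrightarrow>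
    (\<exists>P. natural_transformation C (pull_bif F (hom_bif D)) (hom_bif C) P \<and>
         nt_eq C (hom_bif C) (nt_comp (FMor F) (nt_comp P (FMor F))) (FMor F))"

lemma (in cat_functor) natural_transformation_FMor:
  "natural_transformation C (hom_bif C) (pull_bif F (hom_bif D)) (FMor F)"
  unfolding natural_transformation_def hom_bif_def pull_bif_def
  by (simp add: FMor_closed FMor_Comp dom.Comp_closed)


section \<open>Idempotent completion\<close>

definition idem_completion :: "('o, 'm) precategory \<Rightarrow> ('o \<times> 'm, 'm) precategory" where
  "idem_completion C =
    \<lparr>Obj = {(X, e). X \<in> Obj C \<and> e \<in> Hom C X X \<and> Comp C X X X e e = e},
     Hom = (\<lambda>(X, e) (X', e'). {f \<in> Hom C X X'. f = Comp C X X' X' e' (Comp C X X X' f e)}),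
     Comp = (\<lambda>(X, _) (Y, _) (Z, _). Comp C X Y Z),
     Ident = (\<lambda>(X, e). e)\<rparr>"

definition functor_completion ::
  "('o, 'm, 'p, 'n) prefunctor \<Rightarrow> ('o \<times> 'm, 'm, 'p \<times> 'n, 'n) prefunctor" where
  "functor_completion F =
    \<lparr>FObj = (\<lambda>(X, e). (FObj F X, FMor F X X e)),
     FMor = (\<lambda>(X, _) (Y, _). FMor F X Y)\<rparr>"

context category
begin

lemma idem_absorb:
  assumes "X \<in> Obj C" "Y \<in> Obj C" "e \<in> Hom C X X" "e' \<in> Hom C Y Y"
    and "Comp C X X X e e = e" "Comp C Y Y Y e' e' = e'"
    and "f \<in> Hom C X Y" "f = Comp C X Y Y e' (Comp C X X Y f e)"
  shows "Comp C X Y Y e' f = f" "Comp C X X Y f e = f"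
proof -
  have fe: "Comp C X X Y f e \<in> Hom C X Y"
    using assms Comp_closed by blast
  have "Comp C X Y Y e' f = Comp C X Y Y e' (Comp C X Y Y e' (Comp C X X Y f e))"
    using assms(8) by simp
  also have "\<dots> = Comp C X Y Y (Comp C Y Y Y e' e') (Comp C X X Y f e)"
    using assms(1-4) fe Comp_assoc by blast
  also have "\<dots> = f" using assms(6,8) by simp
  finally show "Comp C X Y Y e' f = f" .
  have "Comp C X X Y f e = Comp C X X Y (Comp C X Y Y e' (Comp C X X Y f e)) e"
    using assms(8) by simp
  also have "\<dots> = Comp C X Y Y e' (Comp C X X Y (Comp C X X Y f e) e)"
    using assms(1-4) fe Comp_assoc by metis
  also have "Comp C X X Y (Comp C X X Y f e) e = Comp C X X Y f (Comp C X X X e e)"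
    using assms(1-3,7) Comp_assoc by metis
  also have "Comp C X Y Y e' (Comp C X X Y f (Comp C X X X e e)) = f"
    using assms(5,8) by simp
  finally show "Comp C X X Y f e = f" .
qed

lemma category_idem_completion: "category (idem_completion C)"
proof (unfold_locales, goal_cases)
  case (1 X Y Z f g)
  obtain X0 e Y0 e' Z0 e'' where eq: "X = (X0, e)" "Y = (Y0, e')" "Z = (Z0, e'')"
    by (metis surj_pair)
  note A = 1[unfolded eq idem_completion_def, simplified]
  have f: "Comp C X0 X0 Y0 f e = f" by (rule idem_absorb) (use A in auto)
  have g: "Comp C Y0 Z0 Z0 e'' g = g" by (rule idem_absorb) (use A in auto)
  have gf: "Comp C X0 Y0 Z0 g f \<in> Hom C X0 Z0" using A Comp_closed by blast
  have "Comp C X0 X0 Z0 (Comp C X0 Y0 Z0 g f) e = Comp C X0 Y0 Z0 g f"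
    using A f Comp_assoc by metis
  moreover have "Comp C X0 Z0 Z0 e'' (Comp C X0 Y0 Z0 g f) = Comp C X0 Y0 Z0 g f"
    using A g Comp_assoc by metis
  ultimately show ?case using gf by (simp add: eq idem_completion_def)
next
  case (2 X)
  then show ?case by (auto simp: idem_completion_def)
next
  case (3 W X Y Z f g h)
  then show ?case by (auto simp: idem_completion_def intro: Comp_assoc)
next
  case (4 X Y f)
  then show ?case by (auto simp: idem_completion_def intro: idem_absorb(2))
next
  case (5 X Y f)
  then show ?case by (auto simp: idem_completion_def intro: idem_absorb(1))
qed

end

lemma (in cat_functor) cat_functor_functor_completion:
  "cat_functor (idem_completion C) (idem_completion D) (functor_completion F)"
proof -
  interpret Cn: category "idem_completion C" by (rule dom.category_idem_completion)
  interpret Dn: category "idem_completion D" by (rule cod.category_idem_completion)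
  show ?thesis
  proof (unfold_locales, goal_cases)
    case (1 X)
    then show ?case
      by (auto simp: idem_completion_def functor_completion_def FObj_closed FMor_closed
            simp flip: FMor_Comp)
  next
    case (2 X Y f)
    obtain X0 e Y0 e' where eq: "X = (X0, e)" "Y = (Y0, e')" by (metis surj_pair)
    note A = 2[unfolded eq idem_completion_def, simplified]
    have o: "X0 \<in> Obj C" "Y0 \<in> Obj C" and m: "e \<in> Hom C X0 X0" "e' \<in> Hom C Y0 Y0" "f \<in> Hom C X0 Y0"
      and feq: "f = Comp C X0 Y0 Y0 e' (Comp C X0 X0 Y0 f e)"
      using A by blast+
    have fe: "Comp C X0 X0 Y0 f e \<in> Hom C X0 Y0" by (rule dom.Comp_closed) (use o m in auto)
    have "FMor F X0 Y0 f = FMor F X0 Y0 (Comp C X0 Y0 Y0 e' (Comp C X0 X0 Y0 f e))"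
      using feq by simp
    also have "\<dots> = Comp D (FObj F X0) (FObj F Y0) (FObj F Y0) (FMor F Y0 Y0 e')
      (Comp D (FObj F X0) (FObj F X0) (FObj F Y0) (FMor F X0 Y0 f) (FMor F X0 X0 e))"
      by (simp add: FMor_Comp[OF o(1) o(2) o(2) fe m(2)] FMor_Comp[OF o(1) o(1) o(2) m(1) m(3)])
    finally show ?case
      using A by (simp add: eq idem_completion_def functor_completion_def FMor_closed)
  next
    case (3 X Y Z f g)
    then show ?case by (auto simp: idem_completion_def functor_completion_def FMor_Comp)
  next
    case (4 X)
    then show ?case by (auto simp: idem_completion_def functor_completion_def)
  qed
qed

end

theory Submission
  imports Defs
begin

text \<open>
  A natural transformation \<open>P : Hom\<^sub>D(F-,F-) \<rightarrow> Hom\<^sub>C(-,-)\<close> satisfies \<open>P (F e' \<circ> s \<circ> F e) = e' \<circ> P s \<circ> e\<close>,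
  so it preserves the hom-sets of the idempotent completions and restricts to one for the completed
  functor.  Conversely, one for the completed functor is restricted along the full embedding
  \<open>X \<mapsto> (X, Id\<^sub>X)\<close>.  Both passages leave the underlying maps alone, so they preserve each of the
  three defining identities.
\<close>

lemma Obj_idem_completion [simp]:
  "(X, e) \<in> Obj (idem_completion C) \<longleftrightarrow> X \<in> Obj C \<and> e \<in> Hom C X X \<and> Comp C X X X e e = e"
  by (simp add: idem_completion_def)

lemma Hom_idem_completion [simp]:
  "f \<in> Hom (idem_completion C) (X, e) (Y, e') \<longleftrightarrow>
    f \<in> Hom C X Y \<and> f = Comp C X Y Y e' (Comp C X X Y f e)"
  by (simp add: idem_completion_def)

lemma Comp_idem_completion [simp]:
  "Comp (idem_completion C) (X, e) (Y, e') (Z, e'') = Comp C X Y Z"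
  by (simp add: idem_completion_def)

lemma FObj_functor_completion [simp]:
  "FObj (functor_completion F) (X, e) = (FObj F X, FMor F X X e)"
  by (simp add: functor_completion_def)

lemma FMor_functor_completion [simp]:
  "FMor (functor_completion F) (X, e) (Y, e') = FMor F X Y"
  by (simp add: functor_completion_def)

lemma BSet_hom_bif [simp]: "BSet (hom_bif C) = Hom C"
  by (simp add: hom_bif_def)

lemma BSet_pull_bif [simp]: "BSet (pull_bif F S) X Y = BSet S (FObj F X) (FObj F Y)"
  by (simp add: pull_bif_def)

lemma BMor_hom_bif [simp]:
  "BMor (hom_bif C) X X' Y Y' a b h = Comp C X' Y Y' b (Comp C X' X Y h a)"
  by (simp add: hom_bif_def)

lemma BMor_pull_bif [simp]:
  "BMor (pull_bif F S) X X' Y Y' a b =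
    BMor S (FObj F X) (FObj F X') (FObj F Y) (FObj F Y') (FMor F X' X a) (FMor F Y Y' b)"
  by (simp add: pull_bif_def)

context category
begin

lemma Ident_Obj_idem_completion:
  "X \<in> Obj C \<Longrightarrow> (X, Ident C X) \<in> Obj (idem_completion C)"
  by (simp add: Ident_closed Ident_left)

text \<open>Fullness of the embedding: when both idempotents are identities, the unit laws make the
  defining condition on morphisms automatic.\<close>

lemma Hom_idem_completion_Ident:
  "\<lbrakk>X \<in> Obj C; Y \<in> Obj C\<rbrakk>
    \<Longrightarrow> Hom (idem_completion C) (X, Ident C X) (Y, Ident C Y) = Hom C X Y"
  by (auto simp: Ident_right Ident_left)

end

lemma natural_transformationD:
  assumes "natural_transformation C S T \<eta>" "X \<in> Obj C" "Y \<in> Obj C" "s \<in> BSet S X Y"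
  shows "\<eta> X Y s \<in> BSet T X Y"
    and "\<lbrakk>X' \<in> Obj C; Y' \<in> Obj C; a \<in> Hom C X' X; b \<in> Hom C Y Y'\<rbrakk>
      \<Longrightarrow> \<eta> X' Y' (BMor S X X' Y Y' a b s) = BMor T X X' Y Y' a b (\<eta> X Y s)"
  using assms unfolding natural_transformation_def by blast+

context cat_functor
begin

text \<open>The idempotents are simply forgotten, and naturality is inherited. The point to check is
  that \<open>P X Y\<close> sends morphisms absorbing \<open>F e\<close> and \<open>F e'\<close> to
  morphisms absorbing \<open>e\<close> and \<open>e'\<close>.\<close>

lemma natural_transformation_completion:
  assumes P: "natural_transformation C (pull_bif F (hom_bif D)) (hom_bif C) P"
  shows "natural_transformation (idem_completion C)
    (pull_bif (functor_completion F) (hom_bif (idem_completion D))) (hom_bif (idem_completion C))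
    (\<lambda>(X, _) (Y, _). P X Y)"
proof -
  note closed = natural_transformationD(1)[OF P, simplified]
    and natural = natural_transformationD(2)[OF P, simplified]
  have "P X Y s = Comp C X Y Y e' (Comp C X X Y (P X Y s) e)"
    if "X \<in> Obj C" "Y \<in> Obj C" "e \<in> Hom C X X" "e' \<in> Hom C Y Y"
      "s \<in> Hom D (FObj F X) (FObj F Y)"
      "s = Comp D (FObj F X) (FObj F Y) (FObj F Y) (FMor F Y Y e')
        (Comp D (FObj F X) (FObj F X) (FObj F Y) s (FMor F X X e))" for X Y e e' s
    \<comment> \<open>Naturality is applied to the endomorphisms \<open>e\<close> and
      \<open>e'\<close> themselves; the fixed-point hypothesis on \<open>s\<close> collapses the
      left side of the square to \<open>P X Y s\<close>.\<close>
    using natural[of X Y s X Y e e'] that by simp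
  then show ?thesis
    unfolding natural_transformation_def by (auto simp: closed natural)
qed

text \<open>Since \<open>F\<close> preserves identities, the completed functor sends
  \<open>(X, Ident C X)\<close> to \<open>(FObj F X, Ident D (FObj F X))\<close>. It thus commutes
  with the two embeddings, and the hom-sets on both sides become those of \<open>C\<close> and
  \<open>D\<close>.\<close>

lemmas restrict_simps = FMor_Ident FObj_closed
  dom.Ident_Obj_idem_completion dom.Hom_idem_completion_Ident cod.Hom_idem_completion_Ident

lemma natural_transformation_restrict:
  assumes Q: "natural_transformation (idem_completion C)
    (pull_bif (functor_completion F) (hom_bif (idem_completion D))) (hom_bif (idem_completion C)) Q"
  shows "natural_transformation C (pull_bif F (hom_bif D)) (hom_bif C)
    (\<lambda>X Y. Q (X, Ident C X) (Y, Ident C Y))"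
proof -
  note idem = dom.Ident_Obj_idem_completion
  \<comment> \<open>All objects are specialised to embedded ones; the morphisms stay
    arbitrary.\<close>
  note closed = natural_transformationD(1)[OF Q idem idem]
    and natural = natural_transformationD(2)[OF Q idem idem _ idem idem]
  show ?thesis
    unfolding natural_transformation_def
  proof (intro conjI ballI, goal_cases)
    case (1 X Y s)
    then show ?case
      using closed[of X Y s]
      \<comment> \<open>The componentwise rules are switched off so that embedded objects and their
        hom-sets are treated as a whole, through fullness.\<close>
      by (simp add: restrict_simps del: Obj_idem_completion Hom_idem_completion)
  next
    case (2 X X' Y Y' a b s)
    then show ?case
      using natural[of X Y s X' Y' a b]
      by (simp add: restrict_simps del: Obj_idem_completion Hom_idem_completion)
  qed
qed

lemma semiseparable_functor_completion:
  "semiseparable (idem_completion C) (idem_completion D) (functor_completion F)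
    \<longleftrightarrow> semiseparable C D F" (is "?L \<longleftrightarrow> ?R")
proof
  assume ?L
  then obtain Q where "natural_transformation (idem_completion C)
      (pull_bif (functor_completion F) (hom_bif (idem_completion D)))
      (hom_bif (idem_completion C)) Q"
    and eq: "nt_eq (idem_completion C) (hom_bif (idem_completion C))
      (nt_comp (FMor (functor_completion F)) (nt_comp Q (FMor (functor_completion F))))
      (FMor (functor_completion F))"
    unfolding semiseparable_def by blast
  moreover have "nt_eq C (hom_bif C)
      (nt_comp (FMor F) (nt_comp (\<lambda>X Y. Q (X, Ident C X) (Y, Ident C Y)) (FMor F))) (FMor F)"
    using eq[unfolded nt_eq_def, rule_format,
        OF dom.Ident_Obj_idem_completion dom.Ident_Obj_idem_completion]
    by (simp add: restrict_simps nt_eq_def nt_comp_def nt_id_def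
        del: Obj_idem_completion Hom_idem_completion)
  ultimately show ?R
    unfolding semiseparable_def using natural_transformation_restrict by blast
next
  assume ?R
  then obtain P where "natural_transformation C (pull_bif F (hom_bif D)) (hom_bif C) P"
    and eq: "nt_eq C (hom_bif C) (nt_comp (FMor F) (nt_comp P (FMor F))) (FMor F)"
    unfolding semiseparable_def by blast
  moreover have "nt_eq (idem_completion C) (hom_bif (idem_completion C))
      (nt_comp (FMor (functor_completion F))
        (nt_comp (\<lambda>(X, _) (Y, _). P X Y) (FMor (functor_completion F))))
      (FMor (functor_completion F))"
    \<comment> \<open>Each hom-set of the completion is a subset of a hom-set of \<open>C\<close>,
      and both maps act there as \<open>P\<close> and \<open>F\<close> do, so the identity is
      inherited.\<close>
    using eq by (auto simp: nt_eq_def nt_comp_def)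
  ultimately show ?L
    unfolding semiseparable_def using natural_transformation_completion by blast
qed

lemma separable_functor_completion:
  "separable (idem_completion C) (idem_completion D) (functor_completion F)
    \<longleftrightarrow> separable C D F" (is "?L \<longleftrightarrow> ?R")
proof
  assume ?L
  then obtain Q where "natural_transformation (idem_completion C)
      (pull_bif (functor_completion F) (hom_bif (idem_completion D)))
      (hom_bif (idem_completion C)) Q"
    and eq: "nt_eq (idem_completion C) (hom_bif (idem_completion C))
      (nt_comp Q (FMor (functor_completion F))) nt_id"
    unfolding separable_def by blast
  moreover have "nt_eq C (hom_bif C)
      (nt_comp (\<lambda>X Y. Q (X, Ident C X) (Y, Ident C Y)) (FMor F)) nt_id"
    using eq[unfolded nt_eq_def, rule_format,
        OF dom.Ident_Obj_idem_completion dom.Ident_Obj_idem_completion]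
    by (simp add: restrict_simps nt_eq_def nt_comp_def nt_id_def
        del: Obj_idem_completion Hom_idem_completion)
  ultimately show ?R
    unfolding separable_def using natural_transformation_restrict by blast
next
  assume ?R
  then obtain P where "natural_transformation C (pull_bif F (hom_bif D)) (hom_bif C) P"
    and eq: "nt_eq C (hom_bif C) (nt_comp P (FMor F)) nt_id"
    unfolding separable_def by blast
  moreover have "nt_eq (idem_completion C) (hom_bif (idem_completion C))
      (nt_comp (\<lambda>(X, _) (Y, _). P X Y) (FMor (functor_completion F))) nt_id"
    using eq by (auto simp: nt_eq_def nt_comp_def nt_id_def)
  ultimately show ?L
    unfolding separable_def using natural_transformation_completion by blast
qed

text \<open>Here the identity is tested on morphisms of \<open>D\<close> between images of
  \<open>F\<close>, so restricting it also needs fullness of the embedding of \<open>D\<close>,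
  available because \<open>F\<close> preserves identities.\<close>

lemma naturally_full_functor_completion:
  "naturally_full (idem_completion C) (idem_completion D) (functor_completion F)
    \<longleftrightarrow> naturally_full C D F" (is "?L \<longleftrightarrow> ?R")
proof
  assume ?L
  then obtain Q where "natural_transformation (idem_completion C)
      (pull_bif (functor_completion F) (hom_bif (idem_completion D)))
      (hom_bif (idem_completion C)) Q"
    and eq: "nt_eq (idem_completion C)
      (pull_bif (functor_completion F) (hom_bif (idem_completion D)))
      (nt_comp (FMor (functor_completion F)) Q) nt_id"
    unfolding naturally_full_def by blast
  moreover have "nt_eq C (pull_bif F (hom_bif D))
      (nt_comp (FMor F) (\<lambda>X Y. Q (X, Ident C X) (Y, Ident C Y))) nt_id"
    using eq[unfolded nt_eq_def, rule_format,
        OF dom.Ident_Obj_idem_completion dom.Ident_Obj_idem_completion]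
    by (simp add: restrict_simps nt_eq_def nt_comp_def nt_id_def
        del: Obj_idem_completion Hom_idem_completion)
  ultimately show ?R
    unfolding naturally_full_def using natural_transformation_restrict by blast
next
  assume ?R
  then obtain P where "natural_transformation C (pull_bif F (hom_bif D)) (hom_bif C) P"
    and eq: "nt_eq C (pull_bif F (hom_bif D)) (nt_comp (FMor F) P) nt_id"
    unfolding naturally_full_def by blast
  moreover have "nt_eq (idem_completion C)
      (pull_bif (functor_completion F) (hom_bif (idem_completion D)))
      (nt_comp (FMor (functor_completion F)) (\<lambda>(X, _) (Y, _). P X Y)) nt_id"
    \<comment> \<open>The inclusion used now is that of hom-sets of the completion of
      \<open>D\<close> in those of \<open>D\<close>.\<close>
    using eq by (auto simp: nt_eq_def nt_comp_def nt_id_def)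
  ultimately show ?L
    unfolding naturally_full_def using natural_transformation_completion by blast
qed

end

theorem corollary2p2:
  fixes C :: "('o, 'm) precategory" and D :: "('p, 'n) precategory"
    and F :: "('o, 'm, 'p, 'n) prefunctor"
  assumes "category C" and "category D" and "cat_functor C D F"
  shows "(semiseparable C D F \<longleftrightarrow>
            semiseparable (idem_completion C) (idem_completion D) (functor_completion F)) \<and>
         (separable C D F \<longleftrightarrow>
            separable (idem_completion C) (idem_completion D) (functor_completion F)) \<and>
         (naturally_full C D F \<longleftrightarrow>
            naturally_full (idem_completion C) (idem_completion D) (functor_completion F))"
proof -
  interpret cat_functor C D F by fact
  show ?thesis
    by (simp add: semiseparable_functor_completion separable_functor_completion
        naturally_full_functor_completion)
qed

end
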